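(* Let $C$ be the number of classes, $n$ the sample size, $\delta\in(0,1)$, $\mathbf{u}=(1/C,\dots,1/C)$ the class-balanced prior, $\boldsymbol\pi=(\pi_1,\dots,\pi_C)$ the empirical long-tailed class prior, and $\mathbf{q}^\star=(q_1^\star,\dots,q_C^\star)$ the stationary class-level sampling distribution of SGS. For a class-level distribution $\mathbf{q}$, let $\widehat{\mathcal L}_{\mathbf q,S}^{\rho}(w)$ be the SAM sharp empirical risk under $\mathbf{q}$ at model weights $w$, and let $$\mathcal B(\mathbf q)=\|\mathbf q-\mathbf u\|_1+\frac1C\sum_{c=1}^{C}\Phi(q_c),$$ where $\Phi(q_c)$ is the PAC complexity term of class $c$, which decreases as the effective class sample size $nq_c$ increases. Assume: (1) the sharp loss is bounded, and each class has admissible positive effective sample size, $n\pi_c>1$ and $nq_c^\star>1$ for all $c$; (2) the movement from $\boldsymbol\pi$ to $\mathbf q^\star$ admits an equalizing-transfer decomposition in the effective-sample region; (3) $\|\mathbf q^\star-\mathbf u\|_1<\|\boldsymbol\pi-\mathbf u\|_1$; (4) any increase in sharp empirical risk is smaller than the reduction in $\mathcal B$: if $\widehat{\mathcal L}_{\mathbf q^\star,S}^{\rho}(w)>\widehat{\mathcal L}_{\boldsymbol\pi,S}^{\rho}(w)$, then $$\widehat{\mathcal L}_{\mathbf q^\star,S}^{\rho}(w)-\widehat{\mathcal L}_{\boldsymbol\pi,S}^{\rho}(w)<\mathcal B(\boldsymbol\pi)-\mathcal B(\mathbf q^\star).$$ Then, with probability at least $1-\delta$ (over the sample $S$), SGS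 has a tighter PAC-Bayes right-hand side than ordinary long-tailed SAM: $$\widehat{\mathcal L}_{\mathbf q^\star,S}^{\rho}(w)+\mathcal B(\mathbf q^\star)<\widehat{\mathcal L}_{\boldsymbol\pi,S}^{\rho}(w)+\mathcal B(\boldsymbol\pi).$$
   Context: Class-level distributions are probability vectors on $\{1,\dots,C\}$. The empirical prior is $\pi_c=N_c/N$, where $N_c$ is the number of training instances in class $c$ and $N=\sum_cN_c$. SAM is Sharpness-Aware Minimization with perturbation radius $\rho>0$; ordinary long-tailed SAM samples classes according to $\boldsymbol\pi$. SGS (Sharpness-Guided Equilibrium Sampling) samples classes according to a dynamic class-level distribution (instances being uniform within a class). Its stationary class-level distribution is the probability vector $\mathbf q^\star$; each coordinate is motivated by frozen-coefficient dynamics $dq=-a_cq\,dt+q\tilde\sigma_c\circ dW_t$ with stationary density proportional to $q^{-(1+2a_c/\tilde\sigma_c^2)}$ on a compact subinterval of $(0,1)$. No explicit formula for $\mathbf q^\star$ is used; it enters only through assumptions (1)--(4). Sharp empirical risk. For a class-level distribution $\mathbf q$ with $nq_c>1$ for all $c$, let $n_c=nq_c$ be the effective sample size of class $c$ and $S_c$ the (possibly reweighted) effective class-$c$ sample induced by the sampler. With $\ell$ the loss, whose perturbed (sharp) version is bounded, $$\widehat{\mathcal L}_{c,S}^{\rho}(w)=\frac1{n_c}\sum_{z_i\in S_c}\max_{\|\epsilon\|_2\le\rho}\ell(w+\epsilon,z_i),\qquad \widehat{\mathcal L}_{\mathbf q,S}^{\rho}(w)=\sum_{c=1}^{C}q_c\,\widehat{\mathcal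 L}_{c,S}^{\rho}(w).$$ PAC complexity term. With $\mathcal P_w$ the PAC-Bayes posterior and $\mathcal P_0$ the prior (with finite KL divergence), for $q>1/n$, $$\Phi(q)=\sqrt{\frac{\mathrm{KL}(\mathcal P_w\|\mathcal P_0)+\log(Cnq/\delta)}{2(nq-1)}}.$$ The "PAC-Bayes right-hand side" for sampling distribution $\mathbf q$ is the quantity $\widehat{\mathcal L}_{\mathbf q,S}^{\rho}(w)+\mathcal B(\mathbf q)$. Equalizing-transfer decomposition in the effective-sample region. This means that there is a finite sequence of class-level distributions $\boldsymbol\pi=\mathbf q^{(0)},\mathbf q^{(1)},\dots,\mathbf q^{(K)}=\mathbf q^\star$ such that each $\mathbf q^{(k+1)}$ is obtained from $\mathbf q=\mathbf q^{(k)}$ by choosing classes $i,j$ with $q_i<q_j$ and an amount $\varepsilon>0$ with $q_i+\varepsilon\le q_j-\varepsilon$ (no crossing), replacing $q_i$ by $q_i+\varepsilon$ and $q_j$ by $q_j-\varepsilon$, and leaving the other coordinates unchanged; moreover each transfer takes place within the region $q>1/n$, on an interval $[q_i,q_j]$ on which $\Phi$ is decreasing and strictly convex. *)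

theory Defs
  imports "HOL-Probability.Probability"
begin

text \<open>The classes are the elements of a finite type \<open>'c\<close>, with \<open>C = CARD('c)\<close>; the weight space
  is a Euclidean space \<open>'w\<close>; instances have type \<open>'z\<close>.\<close>

definition class_distribution :: "('c::finite \<Rightarrow> real) \<Rightarrow> bool" where
  "class_distribution q \<longleftrightarrow> (\<forall>c. 0 \<le> q c) \<and> (\<Sum>c\<in>UNIV. q c) = 1"

definition balanced_prior :: "'c::finite \<Rightarrow> real" where
  "balanced_prior c = 1 / real CARD('c)"

definition empirical_prior :: "('c::finite \<Rightarrow> nat) \<Rightarrow> 'c \<Rightarrow> real" where
  "empirical_prior N c = real (N c) / real (\<Sum>d\<in>UNIV. N d)"

definition l1_dist :: "('c::finite \<Rightarrow> real) \<Rightarrow> ('c \<Rightarrow> real) \<Rightarrow> real" where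
  "l1_dist p q = (\<Sum>c\<in>UNIV. \<bar>p c - q c\<bar>)"

text \<open>The supremum is the maximum whenever the latter is attained, e.g. for a loss that is
  continuous in the weights. It is only meaningful for a set that is bounded above, hence the
  first conjunct in the definition of \<open>bounded_sharp_loss\<close>.\<close>

definition sharp_loss :: "('w::euclidean_space \<Rightarrow> 'z \<Rightarrow> real) \<Rightarrow> real \<Rightarrow> 'w \<Rightarrow> 'z \<Rightarrow> real" where
  "sharp_loss l \<rho> w z = (SUP \<epsilon>\<in>{\<epsilon>. norm \<epsilon> \<le> \<rho>}. l (w + \<epsilon>) z)"

definition bounded_sharp_loss :: "('w::euclidean_space \<Rightarrow> 'z \<Rightarrow> real) \<Rightarrow> real \<Rightarrow> bool" where
  "bounded_sharp_loss l \<rho> \<longleftrightarrow>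
     (\<exists>B. \<forall>w z. bdd_above ((\<lambda>\<epsilon>. l (w + \<epsilon>) z) ` {\<epsilon>. norm \<epsilon> \<le> \<rho>}) \<and> \<bar>sharp_loss l \<rho> w z\<bar> \<le> B)"

text \<open>An effective class sample is a finite multiset of weighted instances \<open>(z, v)\<close>; an
  unweighted (re)sample has all weights \<open>v = 1\<close>. Below, \<open>y z\<close> is the class of the instance \<open>z\<close>
  and \<open>D\<close> is the training sample.\<close>

definition effective_class_sample ::
  "('z \<Rightarrow> 'c) \<Rightarrow> 'z multiset \<Rightarrow> 'c \<Rightarrow> ('z \<times> real) multiset \<Rightarrow> bool" where
  "effective_class_sample y D c T \<longleftrightarrow> (\<forall>(z, v) \<in> set_mset T. z \<in># D \<and> y z = c \<and> 0 \<le> v)"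

definition class_sharp_risk ::
  "('w::euclidean_space \<Rightarrow> 'z \<Rightarrow> real) \<Rightarrow> real \<Rightarrow> nat \<Rightarrow> real \<Rightarrow> ('z \<times> real) multiset \<Rightarrow> 'w \<Rightarrow> real" where
  "class_sharp_risk l \<rho> n qc T w = 1 / (real n * qc) * (\<Sum>(z, v)\<in>#T. v * sharp_loss l \<rho> w z)"

definition sharp_risk ::
  "('w::euclidean_space \<Rightarrow> 'z \<Rightarrow> real) \<Rightarrow> real \<Rightarrow> nat \<Rightarrow> ('c::finite \<Rightarrow> real) \<Rightarrow>
    ('c \<Rightarrow> ('z \<times> real) multiset) \<Rightarrow> 'w \<Rightarrow> real" where
  "sharp_risk l \<rho> n q S w = (\<Sum>c\<in>UNIV. q c * class_sharp_risk l \<rho> n (q c) (S c) w)"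

text \<open>The library's \<^term>\<open>KL_divergence b M N\<close> is the divergence of \<open>N\<close> from \<open>M\<close>, i.e. the
  integral is taken with respect to the second measure.\<close>

definition KL :: "'w measure \<Rightarrow> 'w measure \<Rightarrow> real" where
  "KL P P0 = KL_divergence (exp 1) P0 P"

definition finite_KL :: "'w measure \<Rightarrow> 'w measure \<Rightarrow> bool" where
  "finite_KL P P0 \<longleftrightarrow> absolutely_continuous P0 P \<and> integrable P (entropy_density (exp 1) P0 P)"

definition pac_complexity :: "real \<Rightarrow> nat \<Rightarrow> nat \<Rightarrow> real \<Rightarrow> real \<Rightarrow> real" where
  "pac_complexity kl C n \<delta> q =
     sqrt ((kl + ln (real C * real n * q / \<delta>)) / (2 * (real n * q - 1)))"

definition pac_bound :: "(real \<Rightarrow> real) \<Rightarrow> ('c::finite \<Rightarrow> real) \<Rightarrow> real" where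
  "pac_bound \<Phi> q = l1_dist q balanced_prior + 1 / real CARD('c) * (\<Sum>c\<in>UNIV. \<Phi> (q c))"

definition strictly_convex_on :: "real set \<Rightarrow> (real \<Rightarrow> real) \<Rightarrow> bool" where
  "strictly_convex_on A f \<longleftrightarrow> convex A \<and>
     (\<forall>x\<in>A. \<forall>y\<in>A. \<forall>t. x \<noteq> y \<longrightarrow> 0 < t \<longrightarrow> t < 1 \<longrightarrow>
        f ((1 - t) * x + t * y) < (1 - t) * f x + t * f y)"

definition equalizing_transfer ::
  "(real \<Rightarrow> real) \<Rightarrow> nat \<Rightarrow> ('c::finite \<Rightarrow> real) \<Rightarrow> ('c \<Rightarrow> real) \<Rightarrow> bool" where
  "equalizing_transfer \<Phi> n q q' \<longleftrightarrow>
     (\<exists>i j \<epsilon>. q i < q j \<and> 0 < \<epsilon> \<and> q i + \<epsilon> \<le> q j - \<epsilon> \<and>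
        q' = q(i := q i + \<epsilon>, j := q j - \<epsilon>) \<and>
        1 / real n < q i \<and>
        antimono_on {q i..q j} \<Phi> \<and> strictly_convex_on {q i..q j} \<Phi>)"

definition equalizing_transfer_decomposition ::
  "(real \<Rightarrow> real) \<Rightarrow> nat \<Rightarrow> ('c::finite \<Rightarrow> real) \<Rightarrow> ('c \<Rightarrow> real) \<Rightarrow> bool" where
  "equalizing_transfer_decomposition \<Phi> n p q \<longleftrightarrow>
     (\<exists>K Q. Q 0 = p \<and> Q K = q \<and> (\<forall>k\<le>K. class_distribution (Q k)) \<and>
        (\<forall>k<K. equalizing_transfer \<Phi> n (Q k) (Q (Suc k))))"

end

theory Submission
  imports Defs
begin

text \<open>An equalizing transfer replaces two values by more central ones with the same sum, so by
  convexity it does not increase the sum of the complexity terms (the Schur-convexity argument for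
  Robin Hood transfers). Along the whole decomposition the complexity part of the bound therefore
  does not increase, and the distance to the balanced prior strictly decreases; hence the bound
  strictly decreases, and by hypothesis a possible increase of the empirical risk is smaller than
  this decrease. The comparison of the right-hand sides is thus almost sure.\<close>

text \<open>With \<open>t = e / (b - a)\<close>, the new points are convex combinations of
  \<open>a\<close> and \<open>b\<close> with mirrored weights \<open>(1 - t, t)\<close> and
  \<open>(t, 1 - t)\<close>. Adding the two convexity inequalities makes the weights at each
  endpoint sum to 1.\<close>

lemma strictly_convex_on_transfer:
  fixes f :: "real \<Rightarrow> real"
  assumes "strictly_convex_on {a..b} f" and "a < b" and "0 < e" and "a + e < b"
  shows "f (a + e) + f (b - e) < f a + f b"
proof -
  define t where "t = e / (b - a)"
  have t: "0 < t" "t < 1" and e: "e = t * (b - a)"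
    using assms by (auto simp: t_def field_simps)
  have conv: "f ((1 - s) * a + s * b) < (1 - s) * f a + s * f b" if "0 < s" "s < 1" for s
    using assms(1,2) that by (auto simp: strictly_convex_on_def)
  have "a + e = (1 - t) * a + t * b"
    by (simp add: e algebra_simps)
  with conv[of t] t have "f (a + e) < (1 - t) * f a + t * f b"
    by simp
  moreover have "b - e = t * a + (1 - t) * b"
    by (simp add: e algebra_simps)
  with conv[of "1 - t"] t have "f (b - e) < t * f a + (1 - t) * f b"
    by simp
  ultimately show ?thesis
    by (simp add: algebra_simps)
qed

lemma equalizing_transfer_sum_less:
  fixes q q' :: "'c::finite \<Rightarrow> real"
  assumes "equalizing_transfer \<Phi> n q q'"
  shows "(\<Sum>c\<in>UNIV. \<Phi> (q' c)) < (\<Sum>c\<in>UNIV. \<Phi> (q c))"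
proof -
  obtain i j \<epsilon> where *: "q i < q j" "0 < \<epsilon>" "q i + \<epsilon> \<le> q j - \<epsilon>"
    and q': "q' = q(i := q i + \<epsilon>, j := q j - \<epsilon>)"
    and conv: "strictly_convex_on {q i..q j} \<Phi>"
    using assms unfolding equalizing_transfer_def by blast
  have "i \<noteq> j"
    using *(1) by auto
  have split: "(\<Sum>c\<in>UNIV. \<Phi> (r c)) = \<Phi> (r i) + \<Phi> (r j) + (\<Sum>c\<in>UNIV - {i} - {j}. \<Phi> (r c))"
    for r :: "'c \<Rightarrow> real"
    using \<open>i \<noteq> j\<close> sum.remove[of UNIV i "\<lambda>c. \<Phi> (r c)"]
      sum.remove[of "UNIV - {i}" j "\<lambda>c. \<Phi> (r c)"] by simp
  have "(\<Sum>c\<in>UNIV - {i} - {j}. \<Phi> (q' c)) = (\<Sum>c\<in>UNIV - {i} - {j}. \<Phi> (q c))"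
    by (rule sum.cong) (auto simp: q')
  moreover have "q' i = q i + \<epsilon>" "q' j = q j - \<epsilon>"
    using \<open>i \<noteq> j\<close> by (simp_all add: q')
  ultimately show ?thesis
    \<comment> \<open>The remaining premise \<open>q i + \<epsilon> < q j\<close> follows from the
      no-crossing condition and \<open>0 < \<epsilon>\<close>.\<close>
    using strictly_convex_on_transfer[OF conv *(1,2)] * by (simp add: split[of q] split[of q'])
qed

text \<open>Every transfer is a strict decrease, but the chain may be empty (\<open>K = 0\<close>),
  so only a non-strict inequality holds.\<close>

lemma equalizing_transfer_decomposition_sum_le:
  fixes p q :: "'c::finite \<Rightarrow> real"
  assumes "equalizing_transfer_decomposition \<Phi> n p q"
  shows "(\<Sum>c\<in>UNIV. \<Phi> (q c)) \<le> (\<Sum>c\<in>UNIV. \<Phi> (p c))"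
proof -
  obtain K Q where Q: "Q 0 = p" "Q K = q"
    and step: "\<And>k. k < K \<Longrightarrow> equalizing_transfer \<Phi> n (Q k) (Q (Suc k))"
    using assms unfolding equalizing_transfer_decomposition_def by blast
  have "(\<Sum>c\<in>UNIV. \<Phi> (Q k c)) \<le> (\<Sum>c\<in>UNIV. \<Phi> (Q 0 c))" if "k \<le> K" for k
    using that
  proof (induction k)
    case (Suc k)
    then show ?case
      using equalizing_transfer_sum_less[OF step[of k]] by simp
  qed simp
  from this[of K] show ?thesis
    using Q by simp
qed

text \<open>Strictness comes from the distance term; the complexity term, scaled by a nonnegative
  factor, contributes a non-strict inequality.\<close>

lemma pac_bound_less:
  fixes p q :: "'c::finite \<Rightarrow> real"
  assumes "equalizing_transfer_decomposition \<Phi> n p q"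
    and "l1_dist q balanced_prior < l1_dist p balanced_prior"
  shows "pac_bound \<Phi> q < pac_bound \<Phi> p"
  unfolding pac_bound_def using assms(2) equalizing_transfer_decomposition_sum_le[OF assms(1)]
  by (intro add_less_le_mono mult_left_mono) auto

text \<open>The set where \<open>Q\<close> holds may fail to be measurable, so the event is the
  complement of a null set containing all exceptions.\<close>

lemma (in prob_space) AE_obtain_prob_1:
  assumes "AE x in M. Q x"
  obtains E where "E \<in> events" and "prob E = 1" and "\<And>x. x \<in> E \<Longrightarrow> Q x"
proof -
  from AE_E3[OF assms] obtain A where A: "\<And>x. x \<in> space M - A \<Longrightarrow> Q x" "A \<in> null_sets M"
    by blast
  then have "prob (space M - A) = 1"
    using prob_compl[of A] by (auto simp: measure_eq_0_null_sets)
  with A that show thesis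
    by blast
qed

theorem theorem3:
  fixes M :: "'s measure"
    and D :: "'s \<Rightarrow> 'z multiset"
    and y :: "'z \<Rightarrow> 'c::finite"
    and N :: "'c \<Rightarrow> nat"
    and S :: "('c \<Rightarrow> real) \<Rightarrow> 's \<Rightarrow> 'c \<Rightarrow> ('z \<times> real) multiset"
    and l :: "'w::euclidean_space \<Rightarrow> 'z \<Rightarrow> real"
    and P0 :: "'w measure"
    and P :: "'w \<Rightarrow> 'w measure"
    and w :: 'w
    and n :: nat
    and \<rho> \<delta> :: real
    and qstar :: "'c \<Rightarrow> real"
  defines "\<pi> \<equiv> empirical_prior N"
    and "\<Phi> \<equiv> pac_complexity (KL (P w) P0) CARD('c) n \<delta>"
  defines "risk \<equiv> (\<lambda>q \<omega>. sharp_risk l \<rho> n q (S q \<omega>) w)"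
    and "\<B> \<equiv> (pac_bound \<Phi> :: ('c \<Rightarrow> real) \<Rightarrow> real)"
  assumes "0 < \<delta>" and "\<delta> < 1" and "0 < \<rho>"
    and "prob_space M"
    and "\<And>\<omega> c. \<omega> \<in> space M \<Longrightarrow> size {# z \<in># D \<omega>. y z = c #} = N c"
    and "class_distribution qstar"
    and "\<And>q \<omega> c. q \<in> {\<pi>, qstar} \<Longrightarrow> \<omega> \<in> space M \<Longrightarrow> effective_class_sample y (D \<omega>) c (S q \<omega> c)"
    and "prob_space P0" and "sets P0 = sets borel"
    and "prob_space (P w)" and "sets (P w) = sets borel"
    and "finite_KL (P w) P0"
    and "bounded_sharp_loss l \<rho>"
    and "\<And>c. 1 < real n * \<pi> c" and "\<And>c. 1 < real n * qstar c"
    and "equalizing_transfer_decomposition \<Phi> n \<pi> qstar"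
    and "l1_dist qstar balanced_prior < l1_dist \<pi> balanced_prior"
    and "AE \<omega> in M. risk \<pi> \<omega> < risk qstar \<omega> \<longrightarrow>
           risk qstar \<omega> - risk \<pi> \<omega> < \<B> \<pi> - \<B> qstar"
  shows "\<exists>E\<in>sets M. 1 - \<delta> \<le> measure M E \<and>
           (\<forall>\<omega>\<in>E. risk qstar \<omega> + \<B> qstar < risk \<pi> \<omega> + \<B> \<pi>)"
proof -
  interpret prob_space M by fact
  have "\<B> qstar < \<B> \<pi>"
    unfolding \<B>_def by (rule pac_bound_less) fact+
  \<comment> \<open>Where the risk rises, the hypothesis bounds the rise by the drop of
    \<open>\<B>\<close>; elsewhere the strict drop of \<open>\<B>\<close>, which does not depend on
    \<open>\<omega>\<close>, suffices.\<close>
  have "AE \<omega> in M. risk qstar \<omega> + \<B> qstar < risk \<pi> \<omega> + \<B> \<pi>"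
    using \<open>AE \<omega> in M. risk \<pi> \<omega> < risk qstar \<omega> \<longrightarrow> risk qstar \<omega> - risk \<pi> \<omega> < \<B> \<pi> - \<B> qstar\<close>
    by eventually_elim (use \<open>\<B> qstar < \<B> \<pi>\<close> in auto)
  then obtain E where "E \<in> events" "prob E = 1"
    and "\<And>\<omega>. \<omega> \<in> E \<Longrightarrow> risk qstar \<omega> + \<B> qstar < risk \<pi> \<omega> + \<B> \<pi>"
    by (rule AE_obtain_prob_1) blast
  with \<open>0 < \<delta>\<close> show ?thesis
    \<comment> \<open>The event has probability 1, which exceeds
      \<open>1 - \<delta>\<close>.\<close>
    by (intro bexI[of _ E]) auto
qed

end
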